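(* Let $\mathbf f:[0,T]\to\mathbb R^{n_1\times\cdots\times n_d}$ be the exact solution of $\frac{d\mathbf f}{dt}=\mathbf N(\mathbf f)$, $\mathbf f(0)=\mathbf f_0$, with $\mathbf N$ Lipschitz, and let $\Delta t=T/N$. Consider the rank-adaptive explicit midpoint method $$\mathbf f_{k+1}=\mathfrak T_{\boldsymbol\alpha_k}\left(\mathbf f_k+\Delta t\,\mathfrak T_{\boldsymbol\beta_k}\left(\mathbf N\left(\mathbf f_k+\frac{\Delta t}{2}\,\mathfrak T_{\boldsymbol\gamma_k}(\mathbf N(\mathbf f_k))\right)\right)\right),\qquad k=0,1,\dots,N-1.$$ For $\boldsymbol\kappa\in\{\boldsymbol\alpha_k,\boldsymbol\beta_k,\boldsymbol\gamma_k\}$ let $\varepsilon_{\boldsymbol\kappa}=\|\mathbf g-\mathfrak T_{\boldsymbol\kappa}(\mathbf g)\|_2$, where $\mathbf g$ is the tensor to which $\mathfrak T_{\boldsymbol\kappa}$ is applied in the scheme. If there are constants $A,B,G$, independent of $k$ and $\Delta t$, such that the truncation ranks satisfy $$\varepsilon_{\boldsymbol\alpha_k}\le A\Delta t^3,\qquad \varepsilon_{\boldsymbol\beta_k}\le B\Delta t^2,\qquad \varepsilon_{\boldsymbol\gamma_k}\le G\Delta t$$ for all $k$, then the method has $O(\Delta t^2)$ global error: $\|\mathbf f(T)-\mathbf f_N\|_2\le Q\Delta t^2$ for all sufficiently small $\Delta t$, with $Q$ independent of $\Delta t$.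
   Context: Throughout, $d\ge2$, $\|\cdot\|_2$ is the Euclidean (Frobenius) norm, $\mathbf N$ is a map from $\mathbb R^{n_1\times\cdots\times n_d}$ to itself, and $N$ (not bold) is the number of time steps. Standing assumption: the untruncated explicit midpoint rule has order 2 for the ODE, i.e. there is a constant $K$ with $\|\mathbf y(\Delta t)-(\mathbf g+\Delta t\,\mathbf N(\mathbf g+\tfrac{\Delta t}{2}\mathbf N(\mathbf g)))\|_2\le K\Delta t^3$ for all sufficiently small $\Delta t>0$ and all starting tensors $\mathbf g$ under consideration (values of the exact solution and of the numerical iterates), where $\mathbf y'=\mathbf N(\mathbf y)$, $\mathbf y(0)=\mathbf g$. Hierarchical Tucker format: fix a dimension tree $\mathcal T_d$ (binary tree with root $\{1,\dots,d\}$, leaves the singletons, every non-leaf node the disjoint union of its two children). For $\alpha\in\mathcal T_d$, $\mathbf f^{(\alpha)}$ is the matricization of $\mathbf f$ with rows indexed by the modes in $\alpha$ and columns by the others. For $\mathbf r=\{r_\alpha\}$, $\mathcal H_{\mathbf r}=\{\mathbf f:\operatorname{rank}\mathbf f^{(\alpha)}=r_\alpha\ \forall\alpha\}$, with closure $\overline{\mathcal H}_{\mathbf r}=\{\mathbf f:\operatorname{rank}\mathbf f^{(\alpha)}\le r_\alpha\ \forall\alpha\}$. $\mathfrak T_{\mathbf r}$ denotes any optimal or quasi-optimal truncation operator onto $\overline{\mathcal H}_{\mathbf r}$, e.g. $\mathfrak T^{\rm best}_{\mathbf r}(\mathbf f)\in\operatorname{argmin}_{\mathbf h\in\overline{\mathcal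 H}_{\mathbf r}}\|\mathbf f-\mathbf h\|_2$, or the high-order SVD truncation, which satisfies $\|\mathbf f-\mathfrak T_{\mathbf r}(\mathbf f)\|_2\le\sqrt{2d-3}\,\|\mathbf f-\mathfrak T^{\rm best}_{\mathbf r}(\mathbf f)\|_2$. The ranks may change from step to step. *)

theory Defs
  imports "HOL-Analysis.Analysis" "Jordan_Normal_Form.DL_Rank"
begin

text \<open>
  The modes are \<open>{1..d}\<close> and mode \<open>j\<close> has size \<open>n j\<close>; entries are counted from 0.
  A real tensor of shape \<open>n 1 \<times> \<dots> \<times> n d\<close> is a vector of type \<open>real ^ 'i\<close>, where a bijection
  \<open>pos\<close> from \<open>multi_indices d n\<close> onto the finite type \<open>'i\<close> says which component belongs to which
  multi-index: the entry of \<open>f\<close> at the multi-index \<open>i\<close> is \<open>vec_nth f (pos i)\<close>.  The norm of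
  \<open>real ^ 'i\<close> is then the Frobenius norm.  Since types are nonempty, such a bijection
  exists for some finite type exactly when \<open>n j \<ge> 1\<close> for all modes \<open>j\<close>.
\<close>

definition multi_indices :: "nat \<Rightarrow> (nat \<Rightarrow> nat) \<Rightarrow> (nat \<Rightarrow> nat) set" where
  "multi_indices d n = PiE {1..d} (\<lambda>j. {..<n j})"

text \<open>A dimension tree is represented by the set of its nodes, which are sets of modes.\<close>

inductive dimension_tree :: "nat set \<Rightarrow> nat set set \<Rightarrow> bool" where
  leaf: "dimension_tree {j} {{j}}"
| node: "dimension_tree A U \<Longrightarrow> dimension_tree B V \<Longrightarrow> A \<inter> B = {} \<Longrightarrow>
    dimension_tree (A \<union> B) (insert (A \<union> B) (U \<union> V))"

text \<open>
  Multi-indices over a set \<open>S\<close> of modes are numbered in mixed radix, the smallest mode varying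
  fastest; \<open>mode_digit n S p j\<close> is the \<open>j\<close>-th component of the multi-index number \<open>p\<close>.
\<close>

definition mode_digit :: "(nat \<Rightarrow> nat) \<Rightarrow> nat set \<Rightarrow> nat \<Rightarrow> nat \<Rightarrow> nat" where
  "mode_digit n S p j = (p div (\<Prod>l\<in>{l \<in> S. l < j}. n l)) mod n j"

definition matricization ::
  "nat \<Rightarrow> (nat \<Rightarrow> nat) \<Rightarrow> ((nat \<Rightarrow> nat) \<Rightarrow> 'i::finite) \<Rightarrow> nat set \<Rightarrow> real ^ 'i \<Rightarrow> real mat" where
  "matricization d n pos \<alpha> f =
     Matrix.mat (\<Prod>j\<in>\<alpha>. n j) (\<Prod>j\<in>{1..d} - \<alpha>. n j)
       (\<lambda>(p, q). vec_nth f (pos (\<lambda>j\<in>{1..d}.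
          if j \<in> \<alpha> then mode_digit n \<alpha> p j else mode_digit n ({1..d} - \<alpha>) q j)))"

definition matrix_rank :: "real mat \<Rightarrow> nat" where
  "matrix_rank M = vec_space.rank (dim_row M) M"

text \<open>The closed set of tensors of hierarchical rank at most \<open>r\<close>; only the values of \<open>r\<close> at the
  nodes of the tree matter.\<close>

definition HT_closure ::
  "nat \<Rightarrow> (nat \<Rightarrow> nat) \<Rightarrow> ((nat \<Rightarrow> nat) \<Rightarrow> 'i::finite) \<Rightarrow> nat set set \<Rightarrow> (nat set \<Rightarrow> nat)
    \<Rightarrow> (real ^ 'i) set" where
  "HT_closure d n pos \<T> r = {f. \<forall>\<alpha>\<in>\<T>. matrix_rank (matricization d n pos \<alpha> f) \<le> r \<alpha>}"

definition is_best_approx :: "(real ^ 'i::finite) set \<Rightarrow> real ^ 'i \<Rightarrow> real ^ 'i \<Rightarrow> bool" where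
  "is_best_approx H f h \<longleftrightarrow> is_arg_min (\<lambda>g. norm (f - g)) (\<lambda>g. g \<in> H) h"

text \<open>
  Optimal truncation is the case \<open>C = 1\<close>; truncation by the high-order SVD is quasi-optimal with
  \<open>C = sqrt (2 * d - 3)\<close>.  Best approximations need not be unique, but they all have the same
  distance to \<open>f\<close>, so the choice of \<open>h\<close> is immaterial.
\<close>

definition quasi_optimal_truncation ::
  "real \<Rightarrow> (real ^ 'i::finite) set \<Rightarrow> (real ^ 'i \<Rightarrow> real ^ 'i) \<Rightarrow> bool" where
  "quasi_optimal_truncation C H Tr \<longleftrightarrow>
     (\<forall>f. Tr f \<in> H \<and> (\<forall>h. is_best_approx H f h \<longrightarrow> norm (f - Tr f) \<le> C * norm (f - h)))"

definition trunc_error :: "(real ^ 'i::finite \<Rightarrow> real ^ 'i) \<Rightarrow> real ^ 'i \<Rightarrow> real" where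
  "trunc_error Tr g = norm (g - Tr g)"

definition ode_solution ::
  "(real ^ 'i::finite \<Rightarrow> real ^ 'i) \<Rightarrow> real \<Rightarrow> (real \<Rightarrow> real ^ 'i) \<Rightarrow> real ^ 'i \<Rightarrow> bool" where
  "ode_solution N T y g \<longleftrightarrow>
     y 0 = g \<and> (\<forall>t\<in>{0..T}. (y has_vector_derivative N (y t)) (at t within {0..T}))"

definition midpoint_step ::
  "(real ^ 'i::finite \<Rightarrow> real ^ 'i) \<Rightarrow> real \<Rightarrow> real ^ 'i \<Rightarrow> real ^ 'i" where
  "midpoint_step N h g = g + h *\<^sub>R N (g + (h / 2) *\<^sub>R N g)"

text \<open>The constant \<open>K\<close> and the range of step sizes are uniform over the starting tensors in \<open>S\<close>.\<close>

definition midpoint_order_2_on ::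
  "(real ^ 'i::finite) set \<Rightarrow> (real ^ 'i \<Rightarrow> real ^ 'i) \<Rightarrow> bool" where
  "midpoint_order_2_on S N \<longleftrightarrow>
     (\<exists>K. \<exists>\<delta>>0. \<forall>h. 0 < h \<and> h < \<delta> \<longrightarrow>
        (\<forall>g\<in>S. \<forall>y. ode_solution N h y g \<longrightarrow> norm (y h - midpoint_step N h g) \<le> K * h ^ 3))"

text \<open>The tensors to which the inner, the middle and the outer truncation of the rank-adaptive
  midpoint method are applied in a step of size \<open>h\<close> from \<open>u\<close>.\<close>

definition inner_arg :: "(real ^ 'i::finite \<Rightarrow> real ^ 'i) \<Rightarrow> real ^ 'i \<Rightarrow> real ^ 'i" where
  "inner_arg N u = N u"

definition middle_arg ::
  "(real ^ 'i::finite \<Rightarrow> real ^ 'i) \<Rightarrow> real \<Rightarrow> (real ^ 'i \<Rightarrow> real ^ 'i) \<Rightarrow> real ^ 'i \<Rightarrow> real ^ 'i" where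
  "middle_arg N h Tr\<gamma> u = N (u + (h / 2) *\<^sub>R Tr\<gamma> (inner_arg N u))"

definition outer_arg ::
  "(real ^ 'i::finite \<Rightarrow> real ^ 'i) \<Rightarrow> real \<Rightarrow> (real ^ 'i \<Rightarrow> real ^ 'i) \<Rightarrow> (real ^ 'i \<Rightarrow> real ^ 'i)
    \<Rightarrow> real ^ 'i \<Rightarrow> real ^ 'i" where
  "outer_arg N h Tr\<beta> Tr\<gamma> u = u + h *\<^sub>R Tr\<beta> (middle_arg N h Tr\<gamma> u)"

end

theory Submission
  imports Defs
begin

text \<open>
  The error of a step is split by applying the untruncated midpoint step
  \<open>\<Phi>\<^sub>h = midpoint_step N h\<close> both at \<open>f (t\<^sub>k)\<close> and at \<open>f\<^sub>k\<close>,
    \<open>f (t\<^sub>k\<^sub>+\<^sub>1) - f\<^sub>k\<^sub>+\<^sub>1 = (f (t\<^sub>k\<^sub>+\<^sub>1) - \<Phi>\<^sub>h (f (t\<^sub>k))) + (\<Phi>\<^sub>h (f (t\<^sub>k)) - \<Phi>\<^sub>h (f\<^sub>k)) + (\<Phi>\<^sub>h (f\<^sub>k) - f\<^sub>k\<^sub>+\<^sub>1)\<close>.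
  The first term is the local error of the midpoint rule at a point of the exact solution; it is at
  most \<open>K h\<^sup>3\<close> because a time shift of \<open>f\<close> is again a solution (\<open>ode_solution_shift\<close>).  The second
  term is at most \<open>(1 + M h)\<close> times the previous error, with \<open>M\<close> depending only on the Lipschitz
  constant of \<open>N\<close> and on \<open>T\<close> (\<open>midpoint_step_lipschitz\<close>).  The third term is what the truncations
  do in a single step: an error in the inner stage is multiplied by \<open>h / 2\<close>, by \<open>L\<close> and by \<open>h\<close> on
  its way to the result, an error in the middle stage by \<open>h\<close>, so errors of sizes \<open>G h\<close>, \<open>B h\<^sup>2\<close> and
  \<open>A h\<^sup>3\<close> all contribute at order \<open>h\<^sup>3\<close> (\<open>truncated_step_error\<close>).  Over the \<open>T / h\<close> steps these
  defects of order \<open>h\<^sup>3\<close> add up to \<open>O(h\<^sup>2)\<close>, amplified at most by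
  \<open>exp (M * T)\<close> (\<open>discrete_gronwall\<close>).
\<close>

text \<open>
  The bound with the extra factor \<open>exp c ^ k\<close> in place of the geometric sum of \<open>(1 + c) ^ j\<close>
  is slightly weaker, but it is uniform in \<open>c\<close> down to \<open>c = 0\<close> and needs no division by \<open>c\<close>.
\<close>

lemma discrete_gronwall:
  fixes e :: "nat \<Rightarrow> real"
  assumes e0: "e 0 \<le> 0"
    and step: "\<And>k. k < m \<Longrightarrow> e (Suc k) \<le> (1 + c) * e k + b"
    and c: "c \<ge> 0" and b: "b \<ge> 0"
    and "k \<le> m"
  shows "e k \<le> real k * b * exp c ^ k"
  using \<open>k \<le> m\<close>
proof (induction k)
  case 0
  then show ?case using e0 by simp
next
  case (Suc k)
  let ?E = "exp c"
  have "(1 + c) * e k \<le> (1 + c) * (real k * b * ?E ^ k)"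
    using Suc c by (intro mult_left_mono) auto
  also have "\<dots> \<le> ?E * (real k * b * ?E ^ k)"
    using b by (intro mult_right_mono exp_ge_add_one_self) auto
  finally have old: "(1 + c) * e k \<le> real k * b * ?E ^ Suc k"
    by (simp add: mult_ac)
  have "1 \<le> ?E ^ Suc k"
    using c by (intro one_le_power) simp
  then have new: "b \<le> b * ?E ^ Suc k"
    using b mult_left_mono[of 1 "?E ^ Suc k" b] by simp
  have "e (Suc k) \<le> (1 + c) * e k + b"
    using Suc.prems by (intro step) simp
  also have "\<dots> \<le> real k * b * ?E ^ Suc k + b * ?E ^ Suc k"
    using old new by (rule add_mono)
  also have "\<dots> = real (Suc k) * b * ?E ^ Suc k"
    by (simp add: algebra_simps)
  finally show ?case .
qed

lemma ode_solution_shift: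
  assumes f: "ode_solution N T f f0" and s: "s \<ge> 0" "s + h \<le> T"
  shows "ode_solution N h (\<lambda>t. f (s + t)) (f s)"
  unfolding ode_solution_def
proof (intro conjI ballI)
  show "f (s + 0) = f s" by simp
next
  fix t assume t: "t \<in> {0..h}"
  have "(f has_vector_derivative N (f (s + t))) (at (s + t) within {0..T})"
    using f t s unfolding ode_solution_def by auto
  then have "(f has_vector_derivative N (f (s + t))) (at (s + t) within (\<lambda>t. s + t) ` {0..h})"
    by (rule has_vector_derivative_within_subset) (use s in auto)
  moreover have "((\<lambda>t. s + t) has_vector_derivative 1) (at t within {0..h})"
    by (auto intro!: derivative_eq_intros)
  ultimately have "(f \<circ> (\<lambda>t. s + t) has_vector_derivative 1 *\<^sub>R N (f (s + t))) (at t within {0..h})"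
    by (intro vector_diff_chain_within)
  then show "((\<lambda>t. f (s + t)) has_vector_derivative N (f (s + t))) (at t within {0..h})"
    by (simp add: o_def)
qed

text \<open>
  The factor is one plus a multiple of \<open>h\<close>, which is what keeps its \<open>m\<close>-th power bounded when
  \<open>m * h = T\<close>.
\<close>

lemma midpoint_step_lipschitz:
  fixes N :: "real ^ 'i::finite \<Rightarrow> real ^ 'i"
  assumes N: "L-lipschitz_on UNIV N" and h: "h \<ge> 0"
  shows "norm (midpoint_step N h u - midpoint_step N h v) \<le> (1 + h * (L * (1 + h / 2 * L))) * norm (u - v)"
proof -
  have L: "norm (N x - N y) \<le> L * norm (x - y)" for x y
    using lipschitz_onD[OF N, of x y] by (simp add: dist_norm)
  have L0: "L \<ge> 0" using N by (rule lipschitz_on_nonneg)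
  let ?u = "u + (h / 2) *\<^sub>R N u" and ?v = "v + (h / 2) *\<^sub>R N v"
  have "norm (?u - ?v) = norm ((u - v) + (h / 2) *\<^sub>R (N u - N v))"
    by (simp add: algebra_simps)
  also have "\<dots> \<le> norm (u - v) + h / 2 * norm (N u - N v)"
    using h by (intro norm_triangle_le) simp
  also have "\<dots> \<le> norm (u - v) + h / 2 * (L * norm (u - v))"
    using h by (intro add_left_mono mult_left_mono L) auto
  finally have stage: "norm (?u - ?v) \<le> (1 + h / 2 * L) * norm (u - v)"
    by (simp add: algebra_simps)
  have "norm (midpoint_step N h u - midpoint_step N h v) = norm ((u - v) + h *\<^sub>R (N ?u - N ?v))"
    unfolding midpoint_step_def by (simp add: scaleR_right_diff_distrib add_diff_add)
  also have "\<dots> \<le> norm (u - v) + h * norm (N ?u - N ?v)"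
    using h by (intro norm_triangle_le) simp
  also have "\<dots> \<le> norm (u - v) + h * (L * ((1 + h / 2 * L) * norm (u - v)))"
    using h L0 stage by (intro add_left_mono mult_left_mono order_trans[OF L]) auto
  finally show ?thesis
    by (simp add: algebra_simps)
qed

text \<open>
  Each truncation error is weighted by the powers of \<open>h\<close> and \<open>L\<close> through which it passes on its way
  out of the nested stages.  This is why the inner truncations may be coarser than the outer one
  by one power of \<open>h\<close> per level without a loss of order.
\<close>

lemma truncated_step_error:
  fixes N T1 T2 T3 :: "real ^ 'i::finite \<Rightarrow> real ^ 'i"
  assumes N: "L-lipschitz_on UNIV N" and h: "h \<ge> 0"
  shows "norm (midpoint_step N h u - T3 (outer_arg N h T2 T1 u))
    \<le> trunc_error T3 (outer_arg N h T2 T1 u)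
      + h * trunc_error T2 (middle_arg N h T1 u)
      + h * (L * (h / 2 * trunc_error T1 (inner_arg N u)))"
proof -
  let ?mid = "middle_arg N h T1 u" and ?out = "outer_arg N h T2 T1 u"
  let ?x = "u + (h / 2) *\<^sub>R N u" and ?y = "u + (h / 2) *\<^sub>R T1 (N u)"
  have "?x - ?y = (h / 2) *\<^sub>R (N u - T1 (N u))"
    by (simp add: scaleR_right_diff_distrib)
  then have stage: "norm (?x - ?y) = h / 2 * trunc_error T1 (inner_arg N u)"
    using h by (simp add: trunc_error_def inner_arg_def)
  have mid: "norm (N ?x - ?mid) \<le> L * (h / 2 * trunc_error T1 (inner_arg N u))"
    using lipschitz_onD[OF N, of ?x ?y] unfolding dist_norm stage
    by (simp add: middle_arg_def inner_arg_def)
  have split: "midpoint_step N h u - T3 ?out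
      = (?out - T3 ?out) + h *\<^sub>R (?mid - T2 ?mid) + h *\<^sub>R (N ?x - ?mid)"
    unfolding midpoint_step_def outer_arg_def by (simp add: scaleR_right_diff_distrib)
  have "norm (midpoint_step N h u - T3 ?out)
      \<le> norm (?out - T3 ?out) + h * norm (?mid - T2 ?mid) + h * norm (N ?x - ?mid)"
    unfolding split using h by (intro norm_triangle_le add_mono) auto
  also have "\<dots> \<le> trunc_error T3 ?out + h * trunc_error T2 ?mid
      + h * (L * (h / 2 * trunc_error T1 (inner_arg N u)))"
    using h mid unfolding trunc_error_def by (intro add_mono mult_left_mono) auto
  finally show ?thesis .
qed

theorem mainTheorem4:
  fixes d :: nat and n :: "nat \<Rightarrow> nat" and pos :: "(nat \<Rightarrow> nat) \<Rightarrow> 'i::finite"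
    and \<T> :: "nat set set"
    and Tr :: "(nat set \<Rightarrow> nat) \<Rightarrow> real ^ 'i \<Rightarrow> real ^ 'i" and C :: real
    and N :: "real ^ 'i \<Rightarrow> real ^ 'i" and L :: real
    and f :: "real \<Rightarrow> real ^ 'i" and f0 :: "real ^ 'i" and T :: real
    \<comment> \<open>first argument: the number \<open>m\<close> of time steps, i.e. step size \<open>T / m\<close>; second argument: \<open>k\<close>\<close>
    and F :: "nat \<Rightarrow> nat \<Rightarrow> real ^ 'i"
    and \<alpha> \<beta> \<gamma> :: "nat \<Rightarrow> nat \<Rightarrow> nat set \<Rightarrow> nat"
    and A B G :: real
  assumes "d \<ge> 2"
    and "bij_betw pos (multi_indices d n) UNIV"
    and "dimension_tree {1..d} \<T>"
    and "\<And>r. quasi_optimal_truncation C (HT_closure d n pos \<T> r) (Tr r)"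
    and "L-lipschitz_on UNIV N"
    and "T > 0"
    and "ode_solution N T f f0"
    and "midpoint_order_2_on (f ` {0..T} \<union> {F m k | m k. m \<ge> 1 \<and> k \<le> m}) N"
    and "\<And>m. m \<ge> 1 \<Longrightarrow> F m 0 = f0"
    and "\<And>m k. m \<ge> 1 \<Longrightarrow> k < m \<Longrightarrow>
      F m (Suc k) = Tr (\<alpha> m k) (outer_arg N (T / real m) (Tr (\<beta> m k)) (Tr (\<gamma> m k)) (F m k))"
    and "\<And>m k. m \<ge> 1 \<Longrightarrow> k < m \<Longrightarrow>
      trunc_error (Tr (\<alpha> m k)) (outer_arg N (T / real m) (Tr (\<beta> m k)) (Tr (\<gamma> m k)) (F m k))
        \<le> A * (T / real m) ^ 3"
    and "\<And>m k. m \<ge> 1 \<Longrightarrow> k < m \<Longrightarrow>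
      trunc_error (Tr (\<beta> m k)) (middle_arg N (T / real m) (Tr (\<gamma> m k)) (F m k))
        \<le> B * (T / real m) ^ 2"
    and "\<And>m k. m \<ge> 1 \<Longrightarrow> k < m \<Longrightarrow>
      trunc_error (Tr (\<gamma> m k)) (inner_arg N (F m k)) \<le> G * (T / real m)"
  shows "\<exists>Q. \<exists>\<delta>>0. \<forall>m\<ge>1. T / real m < \<delta> \<longrightarrow>
    norm (f T - F m m) \<le> Q * (T / real m) ^ 2"
proof -
  let ?S = "f ` {0..T} \<union> {F m k | m k. m \<ge> 1 \<and> k \<le> m}"
  obtain K \<delta> where \<delta>: "\<delta> > 0" and order: "\<And>h g y. 0 < h \<Longrightarrow> h < \<delta> \<Longrightarrow> g \<in> ?S \<Longrightarrow>
      ode_solution N h y g \<Longrightarrow> norm (y h - midpoint_step N h g) \<le> K * h ^ 3"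
    using assms(8) unfolding midpoint_order_2_on_def by blast
  have L0: "L \<ge> 0" using assms(5) by (rule lipschitz_on_nonneg)
  define M where "M = L * (1 + T / 2 * L)"
  \<comment> \<open>The given constants may have any sign; the Gronwall bound needs a nonnegative defect.\<close>
  define D where "D = \<bar>K + A + B + L * G / 2\<bar>"
  have M0: "M \<ge> 0" using L0 \<open>T > 0\<close> unfolding M_def by simp
  have bound: "norm (f T - F m m) \<le> (T * D * exp (M * T)) * (T / real m) ^ 2"
    if m: "m \<ge> 1" and small: "T / real m < \<delta>" for m
  proof -
    define h where "h = T / real m"
    have h: "h > 0" "h < \<delta>" "h \<le> T" "real m * h = T"
      using m small \<open>T > 0\<close> unfolding h_def by (auto simp: field_simps)
    define e where "e k = norm (f (real k * h) - F m k)" for k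
    have step: "e (Suc k) \<le> (1 + h * M) * e k + D * h ^ 3" if k: "k < m" for k
    proof -
      let ?t = "real k * h" and ?\<Phi> = "midpoint_step N h"
      have "real (Suc k) * h \<le> real m * h"
        using k h by (intro mult_right_mono) auto
      then have t: "?t \<ge> 0" "?t + h \<le> T"
        using h by (auto simp: algebra_simps)
      have local_error: "norm (f (real (Suc k) * h) - ?\<Phi> (f ?t)) \<le> K * h ^ 3"
        using order[of h "f ?t", OF h(1,2) _ ode_solution_shift[OF assms(7) t]] t h
        by (simp add: algebra_simps)
      have stability: "norm (?\<Phi> (f ?t) - ?\<Phi> (F m k)) \<le> (1 + h * M) * e k"
      proof -
        have "h * (L * (1 + h / 2 * L)) \<le> h * M"
          unfolding M_def using h L0 by (intro mult_left_mono add_mono mult_right_mono) auto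
        then have "(1 + h * (L * (1 + h / 2 * L))) * e k \<le> (1 + h * M) * e k"
          unfolding e_def by (intro mult_right_mono add_left_mono) auto
        with midpoint_step_lipschitz[OF assms(5), of h "f ?t" "F m k"] h show ?thesis
          unfolding e_def by simp
      qed
      have truncation: "norm (?\<Phi> (F m k) - F m (Suc k)) \<le> (A + B + L * G / 2) * h ^ 3"
      proof -
        have "norm (?\<Phi> (F m k) - F m (Suc k))
            \<le> A * h ^ 3 + h * (B * h ^ 2) + h * (L * (h / 2 * (G * h)))"
          unfolding assms(10)[OF m k] h_def[symmetric]
          using h L0 assms(11-13)[OF m k, folded h_def]
          by (intro order_trans[OF truncated_step_error[OF assms(5)]] add_mono mult_left_mono) auto
        then show ?thesis
          by (simp add: algebra_simps power3_eq_cube power2_eq_square)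
      qed
      have "e (Suc k) \<le> norm (f (real (Suc k) * h) - ?\<Phi> (f ?t))
          + norm (?\<Phi> (f ?t) - ?\<Phi> (F m k)) + norm (?\<Phi> (F m k) - F m (Suc k))"
        unfolding e_def
        by (intro order_trans[OF norm_triangle_sub[of _ "f (real (Suc k) * h) - ?\<Phi> (f ?t)"]])
          (use norm_triangle_ineq[of "?\<Phi> (f ?t) - ?\<Phi> (F m k)" "?\<Phi> (F m k) - F m (Suc k)"] in simp)
      also have "\<dots> \<le> (1 + h * M) * e k + (K + A + B + L * G / 2) * h ^ 3"
        using local_error stability truncation by (simp add: algebra_simps)
      also have "\<dots> \<le> (1 + h * M) * e k + D * h ^ 3"
        unfolding D_def using h by (intro add_left_mono mult_right_mono) auto
      finally show ?thesis .
    qed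
    have "e 0 \<le> 0"
      using assms(7) assms(9)[OF m] unfolding e_def ode_solution_def by simp
    then have "e m \<le> real m * (D * h ^ 3) * exp (h * M) ^ m"
      using h M0 by (intro discrete_gronwall[where m = m] step) (auto simp: D_def)
    also have "exp (h * M) ^ m = exp (M * T)"
      by (subst exp_of_nat_mult[symmetric], subst h(4)[symmetric]) (simp only: mult_ac)
    also have "real m * (D * h ^ 3) * exp (M * T) = ((real m * h) * D * exp (M * T)) * h ^ 2"
      by (simp add: power3_eq_cube power2_eq_square)
    finally show ?thesis
      unfolding e_def h(4) by (simp only: h_def)
  qed
  show ?thesis
    using \<delta> bound by blast
qed

end
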